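(* Every chordal graph is partially DP-nice.
   Context: All graphs are nonempty, finite and simple. For $m\in\mathbb{N}=\{1,2,\dots\}$ write $[m]=\{1,\dots,m\}$. A graph is chordal if every cycle of length at least 4 in it has a chord, i.e. an edge joining two nonconsecutive vertices of the cycle. For $S,U\subseteq V(H)$, $E_H(S,U)$ is the set of edges of $H$ with at least one endpoint in $S$ and at least one endpoint in $U$. A cover of a graph $G$ is a pair $\mathcal{H}=(L,H)$ where $H$ is a graph and $L:V(G)\to\mathcal{P}(V(H))$ satisfies: (1) the sets $L(u)$, $u\in V(G)$, partition $V(H)$; (2) $H[L(u)]$ is complete for every $u\in V(G)$; (3) for every $uv\in E(G)$, $E_H(L(u),L(v))$ is a (possibly empty) matching; (4) if $u\neq v$ and $uv\notin E(G)$, then $E_H(L(u),L(v))=\emptyset$. The cover is $m$-fold if $|L(u)|=m$ for all $u\in V(G)$. An $\mathcal{H}$-coloring of $G$ is an independent set of size $|V(G)|$ in $H$. The DP-chromatic number $\chi_{DP}(G)$ is the smallest $m$ such that $G$ has an $\mathcal{H}$-coloring for every $m$-fold cover $\mathcal{H}$ of $G$. For $t\in\mathbb{N}$, the partial DP $t$-chromatic number $\alpha_t^{DP}(G)$ is the minimum of $\alpha(H)$ (the independence number of $H$) over all $t$-fold covers $\mathcal{H}=(L,H)$ of $G$. A graph $G$ is partially DP-nice if $\alpha_t^{DP}(G)\ge t|V(G)|/\chi_{DP}(G)$ for all $t\in[\chi_{DP}(G)]$. *)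

theory Defs
  imports Complex_Main "HOL-Library.Disjoint_Sets"
begin

section \<open>Nonempty finite simple graphs\<close>

datatype 'a ugraph = UGraph (verts: "'a set") (edges: "'a set set")

definition is_graph :: "'a ugraph \<Rightarrow> bool" where
  "is_graph G \<longleftrightarrow> finite (verts G) \<and> verts G \<noteq> {} \<and>
     (\<forall>e\<in>edges G. e \<subseteq> verts G \<and> card e = 2)"

text \<open>The list \<open>c\<close> enumerates the vertices of a cycle of length \<open>length c\<close> in cyclic order.\<close>

definition is_cycle :: "'a ugraph \<Rightarrow> 'a list \<Rightarrow> bool" where
  "is_cycle G c \<longleftrightarrow> 3 \<le> length c \<and> distinct c \<and> set c \<subseteq> verts G \<and>
     (\<forall>i<length c. {c ! i, c ! (Suc i mod length c)} \<in> edges G)"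

definition has_chord :: "'a ugraph \<Rightarrow> 'a list \<Rightarrow> bool" where
  "has_chord G c \<longleftrightarrow> (\<exists>i<length c. \<exists>j<length c.
     i \<noteq> j \<and> j \<noteq> Suc i mod length c \<and> i \<noteq> Suc j mod length c \<and>
     {c ! i, c ! j} \<in> edges G)"

definition chordal :: "'a ugraph \<Rightarrow> bool" where
  "chordal G \<longleftrightarrow> (\<forall>c. is_cycle G c \<and> 4 \<le> length c \<longrightarrow> has_chord G c)"

definition clique :: "'a ugraph \<Rightarrow> 'a set \<Rightarrow> bool" where
  "clique G S \<longleftrightarrow> S \<subseteq> verts G \<and> (\<forall>x\<in>S. \<forall>y\<in>S. x \<noteq> y \<longrightarrow> {x, y} \<in> edges G)"

definition independent_set :: "'a ugraph \<Rightarrow> 'a set \<Rightarrow> bool" where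
  "independent_set G S \<longleftrightarrow> S \<subseteq> verts G \<and> (\<forall>x\<in>S. \<forall>y\<in>S. {x, y} \<notin> edges G)"

definition independence_number :: "'a ugraph \<Rightarrow> nat" where
  "independence_number G = Max (card ` {S. independent_set G S})"

definition edges_between :: "'a ugraph \<Rightarrow> 'a set \<Rightarrow> 'a set \<Rightarrow> 'a set set" where
  "edges_between H S U = {e \<in> edges H. e \<inter> S \<noteq> {} \<and> e \<inter> U \<noteq> {}}"


section \<open>Covers and DP-coloring\<close>

text \<open>Only the values of \<open>L\<close> on \<open>verts G\<close> are relevant. A matching is a set of pairwise
  disjoint edges, which is what \<open>disjoint\<close> expresses in the third condition.\<close>

definition is_cover :: "'a ugraph \<Rightarrow> ('a \<Rightarrow> 'b set) \<Rightarrow> 'b ugraph \<Rightarrow> bool" where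
  "is_cover G L H \<longleftrightarrow> is_graph H \<and>
     disjoint_family_on L (verts G) \<and> (\<Union>u\<in>verts G. L u) = verts H \<and>
     (\<forall>u\<in>verts G. clique H (L u)) \<and>
     (\<forall>u\<in>verts G. \<forall>v\<in>verts G. {u, v} \<in> edges G \<longrightarrow> disjoint (edges_between H (L u) (L v))) \<and>
     (\<forall>u\<in>verts G. \<forall>v\<in>verts G. u \<noteq> v \<and> {u, v} \<notin> edges G \<longrightarrow> edges_between H (L u) (L v) = {})"

definition is_fold_cover :: "nat \<Rightarrow> 'a ugraph \<Rightarrow> ('a \<Rightarrow> 'b set) \<Rightarrow> 'b ugraph \<Rightarrow> bool" where
  "is_fold_cover m G L H \<longleftrightarrow> is_cover G L H \<and> (\<forall>u\<in>verts G. card (L u) = m)"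

definition is_coloring :: "'a ugraph \<Rightarrow> 'b ugraph \<Rightarrow> 'b set \<Rightarrow> bool" where
  "is_coloring G H S \<longleftrightarrow> independent_set H S \<and> card S = card (verts G)"

text \<open>In the next two definitions the vertices of \<open>H\<close> range over \<^typ>\<open>nat\<close>, since HOL cannot
  quantify over types inside a formula. This is no restriction: every finite graph is isomorphic
  to a graph on natural numbers; the lemmas at the end of this theory make this precise.
  Both least elements are attained for every nonempty finite simple graph \<open>G\<close> (and \<open>t \<ge> 1\<close>):
  every \<open>|V(G)|\<close>-fold cover can be colored greedily, and \<open>t\<close>-fold covers exist.\<close>

definition DP_chromatic_number :: "'a ugraph \<Rightarrow> nat" where
  "DP_chromatic_number G = (LEAST m. 1 \<le> m \<and>
     (\<forall>(L :: 'a \<Rightarrow> nat set) H. is_fold_cover m G L H \<longrightarrow> (\<exists>S. is_coloring G H S)))"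

definition partial_DP_chromatic_number :: "nat \<Rightarrow> 'a ugraph \<Rightarrow> nat" where
  "partial_DP_chromatic_number t G = (LEAST k.
     \<exists>(L :: 'a \<Rightarrow> nat set) H. is_fold_cover t G L H \<and> k = independence_number H)"

definition partially_DP_nice :: "'a ugraph \<Rightarrow> bool" where
  "partially_DP_nice G \<longleftrightarrow> (\<forall>t\<in>{1..DP_chromatic_number G}.
     real (partial_DP_chromatic_number t G)
       \<ge> real t * real (card (verts G)) / real (DP_chromatic_number G))"


section \<open>Independence of the vertex type of the cover\<close>

definition relabel :: "('a \<Rightarrow> 'b) \<Rightarrow> 'a ugraph \<Rightarrow> 'b ugraph" where
  "relabel f H = UGraph (f ` verts H) ((`) f ` edges H)"

lemma verts_relabel [simp]: "verts (relabel f H) = f ` verts H"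
  by (simp add: relabel_def)

lemma edges_relabel [simp]: "edges (relabel f H) = (`) f ` edges H"
  by (simp add: relabel_def)

lemma image_mem_edges_iff:
  assumes "is_graph H" "inj_on f (verts H)" "e \<subseteq> verts H"
  shows "f ` e \<in> (`) f ` edges H \<longleftrightarrow> e \<in> edges H"
  using assms by (auto simp: is_graph_def inj_on_image_eq_iff)

lemma pair_mem_edges_map_iff:
  assumes "is_graph H" "inj_on f (verts H)" "x \<in> verts H" "y \<in> verts H"
  shows "{f x, f y} \<in> (`) f ` edges H \<longleftrightarrow> {x, y} \<in> edges H"
  using image_mem_edges_iff[OF assms(1,2), of "{x, y}"] assms(3,4) by simp

lemma is_graph_map:
  assumes "is_graph H" "inj_on f (verts H)"
  shows "is_graph (relabel f H)"
proof -
  have "card (f ` e) = 2" if "e \<in> edges H" for e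
    using assms that by (metis card_image inj_on_subset is_graph_def)
  then show ?thesis using assms(1) by (auto simp: is_graph_def)
qed

lemma independent_set_map_iff:
  assumes "is_graph H" "inj_on f (verts H)" "S \<subseteq> verts H"
  shows "independent_set (relabel f H) (f ` S) \<longleftrightarrow> independent_set H S"
proof -
  have "{f x, f y} \<in> (`) f ` edges H \<longleftrightarrow> {x, y} \<in> edges H" if "x \<in> S" "y \<in> S" for x y
    using pair_mem_edges_map_iff[OF assms(1,2)] that assms(3) by blast
  then show ?thesis using assms(3) by (simp add: independent_set_def image_mono)
qed

lemma independent_set_card_map:
  assumes "is_graph H" "inj_on f (verts H)"
  shows "card ` {S. independent_set (relabel f H) S} = card ` {S. independent_set H S}"
proof -
  have "{S. independent_set (relabel f H) S} = (`) f ` {S. independent_set H S}"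
  proof (intro equalityI subsetI)
    fix T assume "T \<in> {S. independent_set (relabel f H) S}"
    then have T: "independent_set (relabel f H) T" by simp
    then have "T \<subseteq> f ` verts H" by (simp add: independent_set_def)
    then obtain S where S: "S \<subseteq> verts H" "T = f ` S" by (auto simp: subset_image_iff)
    then show "T \<in> (`) f ` {S. independent_set H S}"
      using T independent_set_map_iff[OF assms S(1)] by blast
  next
    fix T assume "T \<in> (`) f ` {S. independent_set H S}"
    then obtain S where S: "independent_set H S" "T = f ` S" by blast
    then have "S \<subseteq> verts H" by (simp add: independent_set_def)
    then show "T \<in> {S. independent_set (relabel f H) S}"
      using S independent_set_map_iff[OF assms] by blast
  qed
  moreover have "card (f ` S) = card S" if "independent_set H S" for S
    using that assms(2) by (metis card_image inj_on_subset independent_set_def)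
  ultimately show ?thesis by (auto simp: image_image)
qed

lemma independence_number_map:
  assumes "is_graph H" "inj_on f (verts H)"
  shows "independence_number (relabel f H) = independence_number H"
  using independent_set_card_map[OF assms] by (simp add: independence_number_def)

lemma edges_between_map:
  assumes "is_graph H" "inj_on f (verts H)" "S \<subseteq> verts H" "U \<subseteq> verts H"
  shows "edges_between (relabel f H) (f ` S) (f ` U) = (`) f ` edges_between H S U"
proof -
  have "f ` e \<inter> f ` A = {} \<longleftrightarrow> e \<inter> A = {}" if "e \<in> edges H" "A \<subseteq> verts H" for e A
    using that assms(1,2) by (metis image_is_empty inj_on_image_Int is_graph_def)
  then have "{e \<in> edges H. f ` e \<inter> f ` S \<noteq> {} \<and> f ` e \<inter> f ` U \<noteq> {}} = edges_between H S U"
    using assms(3,4) by (auto simp only: edges_between_def)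
  moreover have "edges_between (relabel f H) (f ` S) (f ` U) =
      (`) f ` {e \<in> edges H. f ` e \<inter> f ` S \<noteq> {} \<and> f ` e \<inter> f ` U \<noteq> {}}"
    unfolding edges_between_def edges_relabel by blast
  ultimately show ?thesis by simp
qed

lemma is_fold_cover_map:
  assumes cover: "is_fold_cover m G L H" and inj: "inj_on f (verts H)"
  shows "is_fold_cover m G (\<lambda>u. f ` L u) (relabel f H)"
proof -
  have H: "is_graph H" and un: "(\<Union>u\<in>verts G. L u) = verts H"
    and disj: "disjoint_family_on L (verts G)"
    using cover by (auto simp: is_fold_cover_def is_cover_def)
  have sub: "L u \<subseteq> verts H" if "u \<in> verts G" for u using un that by blast
  have 1: "disjoint_family_on (\<lambda>u. f ` L u) (verts G)"
    using disj sub inj unfolding disjoint_family_on_def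
    by (metis image_empty inj_on_image_Int)
  have 2: "(\<Union>u\<in>verts G. f ` L u) = f ` verts H" using un by blast
  have 3: "clique (relabel f H) (f ` L u)" if u: "u \<in> verts G" for u
  proof -
    have "clique H (L u)" using cover u by (auto simp: is_fold_cover_def is_cover_def)
    then show ?thesis using sub[OF u] pair_mem_edges_map_iff[OF H inj]
      unfolding clique_def by (auto simp: subset_iff)
  qed
  have 4: "disjoint (edges_between (relabel f H) (f ` L u) (f ` L v))"
    if uv: "u \<in> verts G" "v \<in> verts G" "{u, v} \<in> edges G" for u v
  proof -
    have "disjoint (edges_between H (L u) (L v))"
      using cover uv by (auto simp: is_fold_cover_def is_cover_def)
    moreover have "e \<subseteq> verts H" if "e \<in> edges_between H (L u) (L v)" for e
      using that H by (auto simp: edges_between_def is_graph_def)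
    ultimately have "disjoint ((`) f ` edges_between H (L u) (L v))"
      unfolding disjoint_def
      by (smt (verit, del_insts) image_empty image_iff inj inj_on_image_Int)
    then show ?thesis using edges_between_map[OF H inj sub[OF uv(1)] sub[OF uv(2)]] by simp
  qed
  have 5: "edges_between (relabel f H) (f ` L u) (f ` L v) = {}"
    if uv: "u \<in> verts G" "v \<in> verts G" "u \<noteq> v" "{u, v} \<notin> edges G" for u v
    using cover uv edges_between_map[OF H inj sub[OF uv(1)] sub[OF uv(2)]]
    by (auto simp: is_fold_cover_def is_cover_def)
  have 6: "card (f ` L u) = m" if u: "u \<in> verts G" for u
    using cover u sub[OF u] inj by (metis card_image inj_on_subset is_fold_cover_def)
  show ?thesis
    unfolding is_fold_cover_def is_cover_def using is_graph_map[OF H inj] 1 2 3 4 5 6 by auto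
qed

text \<open>Covers over any vertex type have counterparts over \<^typ>\<open>nat\<close> with the same independence
  number and the same colorability.\<close>

lemma fold_cover_over_nat:
  fixes L :: "'a \<Rightarrow> 'b set" and H :: "'b ugraph"
  assumes cover: "is_fold_cover m G L H"
  obtains L' :: "'a \<Rightarrow> nat set" and H' :: "nat ugraph"
  where "is_fold_cover m G L' H'" "independence_number H' = independence_number H"
    "(\<exists>S. is_coloring G H' S) \<longleftrightarrow> (\<exists>S. is_coloring G H S)"
proof -
  have H: "is_graph H" using cover by (simp add: is_fold_cover_def is_cover_def)
  then obtain f :: "'b \<Rightarrow> nat" where f: "inj_on f (verts H)"
    using finite_imp_inj_to_nat_seg is_graph_def by metis
  have "(\<exists>S. is_coloring G H S) \<longleftrightarrow> card (verts G) \<in> card ` {S. independent_set H S}"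
    unfolding is_coloring_def image_iff by (metis mem_Collect_eq)
  moreover have "(\<exists>S. is_coloring G (relabel f H) S) \<longleftrightarrow>
      card (verts G) \<in> card ` {S. independent_set (relabel f H) S}"
    unfolding is_coloring_def image_iff by (metis mem_Collect_eq)
  ultimately have "(\<exists>S. is_coloring G (relabel f H) S) \<longleftrightarrow> (\<exists>S. is_coloring G H S)"
    using independent_set_card_map[OF H f] by simp
  then show thesis
    using that[OF is_fold_cover_map[OF cover f] independence_number_map[OF H f]] by blast
qed

end

(* A chordal graph has a perfect elimination order (Dirac): every nonempty vertex set X contains
   a vertex whose neighbours in X form a clique.  Colouring greedily along it shows that G is
   properly colourable with as many colours as its clique number k, and likewise that every t-fold
   cover can be coloured on a vertex set W as soon as G[W] is properly t-colourable, since a clique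
   in W then has at most t vertices.  For t = k and W = V(G) this yields a colouring of G itself,
   so the DP-chromatic number is attained, and it is at least k because of the trivial cover.
   For t <= k let W be the union of the t largest colour classes of a k-colouring:
   W has at least t |V(G)| / k vertices. *)

theory Submission
  imports Defs
begin

section \<open>Simplicial vertices of chordal graphs\<close>

definition simplicial_in :: "'a ugraph \<Rightarrow> 'a set \<Rightarrow> 'a \<Rightarrow> bool" where
  "simplicial_in G X v \<longleftrightarrow> v \<in> X \<and>
     (\<forall>x\<in>X. \<forall>y\<in>X. x \<noteq> y \<and> {v, x} \<in> edges G \<and> {v, y} \<in> edges G \<longrightarrow> {x, y} \<in> edges G)"

lemma edge_neq: "is_graph G \<Longrightarrow> {x, y} \<in> edges G \<Longrightarrow> x \<noteq> y"
  by (auto simp: is_graph_def)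

lemma finite_verts: "is_graph G \<Longrightarrow> finite (verts G)"
  by (simp add: is_graph_def)

section \<open>Shortest walks and induced paths\<close>

lemma relpowp_segment:
  assumes "\<forall>k<n. R (f k) (f (Suc k))" "i \<le> j" "j \<le> n"
  shows "(R ^^ (j - i)) (f i) (f j)"
  unfolding relpowp_fun_conv using assms by (intro exI[of _ "\<lambda>k. f (i + k)"]) auto

text \<open>For a symmetric irreflexive \<open>R\<close> this is an induced path, not necessarily a
  shortest one; inducedness is what rules out chords.\<close>

definition geodesic :: "('a \<Rightarrow> 'a \<Rightarrow> bool) \<Rightarrow> (nat \<Rightarrow> 'a) \<Rightarrow> nat \<Rightarrow> bool" where
  "geodesic R f n \<longleftrightarrow> (\<forall>i<n. R (f i) (f (Suc i))) \<and> inj_on f {..n} \<and>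
     (\<forall>i j. i < j \<longrightarrow> j \<le> n \<longrightarrow> R (f i) (f j) \<longrightarrow> j = Suc i)"

text \<open>A walk of least length works: at a repeated vertex or a forward shortcut, its head and
  tail could be spliced into a shorter walk.\<close>

lemma geodesic_exists:
  assumes "R\<^sup>*\<^sup>* s s'"
  obtains f n where "geodesic R f n" "f 0 = s" "f n = s'"
proof -
  define n where "n = (LEAST n. (R ^^ n) s s')"
  have ex: "\<exists>n. (R ^^ n) s s'" using assms by (simp add: rtranclp_power)
  then have "(R ^^ n) s s'" unfolding n_def by (rule LeastI_ex)
  then obtain f where f: "f 0 = s" "f n = s'" "\<forall>i<n. R (f i) (f (Suc i))"
    unfolding relpowp_fun_conv by blast
  have le: "n \<le> m" if "(R ^^ m) s s'" for m unfolding n_def using that by (rule Least_le)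
  have tail: "(R ^^ (n - j)) (f j) s'" if "j \<le> n" for j
    using relpowp_segment[of n R f j n] f(2,3) that by simp
  have head: "(R ^^ i) s (f i)" if "i \<le> n" for i
    using relpowp_segment[of n R f 0 i] f(1,3) that by simp
  have neq: "f i \<noteq> f j" if "i < j" "j \<le> n" for i j
  proof
    assume "f i = f j"
    then have "(R ^^ (i + (n - j))) s s'"
      using head[of i] tail[of j] that unfolding relpowp_add by auto
    then show False using le that by fastforce
  qed
  have inj: "inj_on f {..n}"
  proof (rule inj_onI)
    fix x y assume "x \<in> {..n}" "y \<in> {..n}" "f x = f y"
    then show "x = y" using neq[of x y] neq[of y x] by (cases x y rule: linorder_cases) auto
  qed
  have short: "j = Suc i" if "i < j" "j \<le> n" "R (f i) (f j)" for i j
  proof -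
    have "(R ^^ Suc i) s (f j)" using head[of i] that by (auto intro: relpowp_Suc_I)
    then have "(R ^^ (Suc i + (n - j))) s s'"
      using tail[of j] that unfolding relpowp_add by auto
    then show ?thesis using le that by fastforce
  qed
  have "geodesic R f n" unfolding geodesic_def
    by (intro conjI allI impI) (use f(3) inj in \<open>auto intro: short\<close>)
  then show thesis using f(1,2) by (rule that)
qed

text \<open>A geodesic from \<open>s\<close> to \<open>s'\<close> outside the neighbourhood of \<open>v\<close>, closed up through \<open>v\<close>,
  would be a chordless cycle.\<close>

lemma chordal_link:
  assumes G: "is_graph G" and ch: "chordal G"
    and v: "v \<in> verts G" and Y: "Y \<subseteq> verts G" "v \<notin> Y" "\<And>y. y \<in> Y \<Longrightarrow> {v, y} \<notin> edges G"
    and s: "s \<in> verts G" "s' \<in> verts G" "{v, s} \<in> edges G" "{v, s'} \<in> edges G" "s \<noteq> s'"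
    and Z: "Z = insert s (insert s' Y)"
    and path: "(\<lambda>x y. {x, y} \<in> edges G \<and> x \<in> Z \<and> y \<in> Z)\<^sup>*\<^sup>* s s'"
  shows "{s, s'} \<in> edges G"
proof (rule ccontr)
  assume nadj: "{s, s'} \<notin> edges G"
  define R where "R = (\<lambda>x y. {x, y} \<in> edges G \<and> x \<in> Z \<and> y \<in> Z)"
  have "R\<^sup>*\<^sup>* s s'" using path by (simp add: R_def)
  then obtain f n where geo: "geodesic R f n" and ends: "f 0 = s" "f n = s'"
    by (rule geodesic_exists)
  have inj: "inj_on f {..n}" and step: "\<forall>i<n. R (f i) (f (Suc i))"
    and short: "\<And>i j. i < j \<Longrightarrow> j \<le> n \<Longrightarrow> R (f i) (f j) \<Longrightarrow> j = Suc i"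
    using geo by (simp_all add: geodesic_def)
  note f = ends step
  have n0: "n \<noteq> 0" using f(1,2) s(5) by metis
  have n1: "n \<noteq> 1" using f nadj by (auto simp: R_def)
  \<comment> \<open>The cycle closed up through \<open>v\<close> has \<open>n + 2\<close> vertices,
    so its length is at least 4 and chordality applies.\<close>
  have n2: "n \<ge> 2" using n0 n1 by linarith
  have fZ: "f i \<in> Z" if "i \<le> n" for i
  proof (cases "i < n")
    case True then show ?thesis using f(3) by (simp add: R_def)
  next
    case False then show ?thesis using that f(2) Z by simp
  qed
  have vZ: "v \<notin> Z" using Y(2) s edge_neq[OF G] Z by blast
  have fY: "f i \<in> Y" if "0 < i" "i < n" for i
  proof -
    have "f i \<noteq> s" using inj that f(1) unfolding inj_on_def by (metis atMost_iff le0 less_imp_le less_irrefl)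
    moreover have "f i \<noteq> s'" using inj that f(2) unfolding inj_on_def by (metis atMost_iff order_refl less_imp_le less_irrefl)
    ultimately show ?thesis using fZ[of i] that Z by auto
  qed
  \<comment> \<open>Prepending \<open>v\<close> shifts indices by one: position 0 is
    \<open>v\<close>, position \<open>Suc i\<close> is \<open>f i\<close>, and the wrap-around edge
    joins \<open>s'\<close> to \<open>v\<close>.\<close>
  define c where "c = v # map f [0..<Suc n]"
  have len: "length c = n + 2" by (simp add: c_def)
  have c0: "c ! 0 = v" by (simp add: c_def)
  have cS: "c ! Suc i = f i" if "i \<le> n" for i
    using that by (simp add: c_def del: upt_Suc)
  have dist: "distinct c"
    using inj fZ vZ unfolding c_def
    by (auto simp: distinct_map atLeast0LessThan lessThan_Suc_atMost simp del: upt_Suc)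
  have fV: "f i \<in> verts G" if "i \<le> n" for i using fZ[OF that] Z Y(1) s(1,2) by auto
  have sub: "set c \<subseteq> verts G"
    using v fV unfolding c_def by (auto simp del: upt_Suc)
  have "{c ! i, c ! (Suc i mod length c)} \<in> edges G" if i: "i < length c" for i
  proof (cases i)
    case 0
    then show ?thesis using c0 cS[of 0] f(1) s(3) len by simp
  next
    case (Suc k)
    show ?thesis
    proof (cases "k < n")
      case True
      then have "Suc i mod length c = Suc (Suc k)" using Suc len by simp
      then show ?thesis using True Suc cS[of k] cS[of "Suc k"] f(3) by (simp add: R_def)
    next
      case False
      then have "k = n" using Suc i len by simp
      then show ?thesis using Suc len cS[of n] c0 f(2) s(4) by (simp add: insert_commute)
    qed
  qed
  then have "is_cycle G c" using n2 len dist sub unfolding is_cycle_def by simp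
  then have "has_chord G c" using ch n2 len unfolding chordal_def by simp
  then obtain i0 j0 where ij0: "i0 < length c" "j0 < length c" "i0 \<noteq> j0"
     "j0 \<noteq> Suc i0 mod length c" "i0 \<noteq> Suc j0 mod length c" "{c ! i0, c ! j0} \<in> edges G"
    unfolding has_chord_def by blast
  obtain i j where ij: "i < j" "j < length c"
     "j \<noteq> Suc i mod length c" "i \<noteq> Suc j mod length c" "{c ! i, c ! j} \<in> edges G"
  proof (cases "i0 < j0")
    case True then show thesis using ij0 that by blast
  next
    case False then show thesis using ij0 that[of j0 i0] by (simp add: insert_commute)
  qed
  obtain b where b: "j = Suc b" "b \<le> n" using ij(1,2) len by (cases j) auto
  \<comment> \<open>A chord at \<open>v\<close> avoids both ends of the path, which are neighbours
    of \<open>v\<close> on the cycle, so it hits an inner vertex, lying in \<open>Y\<close>. A chord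
    between two path vertices is a shortcut.\<close>
  show False
  proof (cases i)
    case 0
    have "b \<noteq> n" using ij(4) 0 b(1) len by auto
    moreover have "b \<noteq> 0" using ij(3) 0 b(1) len by auto
    ultimately have "f b \<in> Y" using fY b by simp
    then show False using Y(3) ij(5) 0 c0 cS[OF b(2)] b(1) by simp
  next
    case (Suc a)
    have ab: "a < b" using Suc ij(1) b(1) by simp
    have "{f a, f b} \<in> edges G" using ij(5) Suc b ab cS[of a] cS[of b] by simp
    then have "R (f a) (f b)" using fZ[of a] fZ[of b] ab b by (simp add: R_def)
    then have "b = Suc a" using short ab b by blast
    then show False using ij(3) Suc b len by simp
  qed
qed

text \<open>Dirac's argument, strengthened to avoid a given \<open>v\<close> so that induction
  works. Let \<open>C\<close> be the component of \<open>u\<close> among the non-neighbours of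
  \<open>v\<close>, and \<open>S\<close> its attachment in the neighbourhood of \<open>v\<close>, a
  clique by \<open>chordal_link\<close>. The smaller set \<open>C \<union> S\<close> has a
  simplicial vertex in \<open>C\<close>, and this one is simplicial in \<open>X\<close> too.\<close>

lemma simplicial_outside_neighbourhood:
  assumes G: "is_graph G" and ch: "chordal G"
  shows "X \<subseteq> verts G \<Longrightarrow> v \<in> X \<Longrightarrow> u \<in> X \<Longrightarrow> u \<noteq> v \<Longrightarrow> {v, u} \<notin> edges G \<Longrightarrow>
    \<exists>w. simplicial_in G X w \<and> w \<noteq> v \<and> {v, w} \<notin> edges G"
proof (induction "card X" arbitrary: X v u rule: less_induct)
  case less
  note X = less.prems(1)
  have finX: "finite X" using X finite_verts[OF G] finite_subset by blast
  define Y where "Y = {y \<in> X. y \<noteq> v \<and> {v, y} \<notin> edges G}"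
  define R where "R = (\<lambda>x y. {x, y} \<in> edges G \<and> x \<in> Y \<and> y \<in> Y)"
  define C where "C = {y. R\<^sup>*\<^sup>* u y}"
  define S where "S = {s \<in> X. {v, s} \<in> edges G \<and> (\<exists>y\<in>C. {s, y} \<in> edges G)}"
  have uY: "u \<in> Y" using less.prems by (simp add: Y_def)
  have CY: "C \<subseteq> Y"
  proof
    fix y assume "y \<in> C"
    then have "R\<^sup>*\<^sup>* u y" by (simp add: C_def)
    then show "y \<in> Y" by (induction rule: rtranclp_induct) (auto simp: uY R_def)
  qed
  have uC: "u \<in> C" by (simp add: C_def)
  \<comment> \<open>A vertex of \<open>C\<close> has no neighbours in \<open>X\<close> beyond
    \<open>C \<union> S\<close>; this carries simpliciality from \<open>C \<union> S\<close> over to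
    \<open>X\<close>.\<close>
  have Cnbr: "x \<in> C \<union> S" if "y \<in> C" "x \<in> X" "{y, x} \<in> edges G" for x y
  proof -
    have "x \<noteq> v" using that CY by (auto simp: Y_def insert_commute)
    show ?thesis
    proof (cases "{v, x} \<in> edges G")
      case True
      then show ?thesis using that by (auto simp: S_def insert_commute)
    next
      case False
      then have "R y x" using that \<open>x \<noteq> v\<close> CY by (auto simp: R_def Y_def)
      then show ?thesis using that(1) by (auto simp: C_def intro: rtranclp.rtrancl_into_rtrancl)
    qed
  qed
  have "symp R" by (auto simp: R_def symp_def insert_commute)
  then have Rsym: "R\<^sup>*\<^sup>* y x" if "R\<^sup>*\<^sup>* x y" for x y
    using that by (meson symp_rtranclp sympD)
  have Sclique: "{s, s'} \<in> edges G" if ss: "s \<in> S" "s' \<in> S" "s \<noteq> s'" for s s'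
  proof -
    \<comment> \<open>The walk from \<open>s\<close> to \<open>s'\<close> through the connected set
      \<open>C\<close> stays in \<open>Y\<close> except at its ends, as \<open>chordal_link\<close>
      demands.\<close>
    define Z where "Z = insert s (insert s' Y)"
    define Q where "Q = (\<lambda>x y. {x, y} \<in> edges G \<and> x \<in> Z \<and> y \<in> Z)"
    obtain y y' where y: "y \<in> C" "{s, y} \<in> edges G" "y' \<in> C" "{s', y'} \<in> edges G"
      using ss by (auto simp: S_def)
    have "R\<^sup>*\<^sup>* y y'" using y(1,3) Rsym rtranclp_trans[of R y u y'] by (simp add: C_def)
    moreover have "R \<le> Q" by (auto simp: R_def Q_def Z_def)
    ultimately have "Q\<^sup>*\<^sup>* y y'" by (metis rtranclp_mono predicate2D)
    moreover have "Q s y" "Q y' s'" using y CY by (auto simp: Q_def Z_def insert_commute)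
    ultimately have "Q\<^sup>*\<^sup>* s s'"
      by (meson converse_rtranclp_into_rtranclp rtranclp.rtrancl_into_rtrancl)
    then have path: "(\<lambda>x y. {x, y} \<in> edges G \<and> x \<in> Z \<and> y \<in> Z)\<^sup>*\<^sup>* s s'"
      by (simp only: Q_def)
    have V: "v \<in> verts G" "s \<in> verts G" "s' \<in> verts G" "Y \<subseteq> verts G" "v \<notin> Y"
      "{v, s} \<in> edges G" "{v, s'} \<in> edges G"
      using X less.prems(2) ss by (auto simp: S_def Y_def)
    have nb: "{v, y} \<notin> edges G" if "y \<in> Y" for y using that by (simp add: Y_def)
    show ?thesis
      by (rule chordal_link[OF G ch V(1,4,5) nb V(2,3,6,7) ss(3) Z_def path])
  qed
  have "v \<notin> C \<union> S" using CY edge_neq[OF G, of v v] by (auto simp: Y_def S_def)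
  moreover have CSX: "C \<union> S \<subseteq> X" using CY by (auto simp: Y_def S_def)
  ultimately have small: "card (C \<union> S) < card X"
    using less.prems(2) finX by (intro psubset_card_mono) auto
  have "\<exists>w\<in>C. simplicial_in G (C \<union> S) w"
  proof (cases "\<exists>x\<in>C \<union> S. \<exists>y\<in>C \<union> S. x \<noteq> y \<and> {x, y} \<notin> edges G")
    case False
    then show ?thesis using uC unfolding simplicial_in_def by blast
  next
    case nonclique: True
    \<comment> \<open>Wanted is an \<open>x\<close> with a non-neighbour but adjacent to the rest of
      \<open>S\<close>. If some vertex of \<open>S\<close> has a non-neighbour, it serves because
      \<open>S\<close> is a clique; otherwise \<open>S\<close> is joined to everything and any
      non-adjacent pair supplies \<open>x\<close>.\<close>
    have "\<exists>x\<in>C \<union> S. (\<exists>y\<in>C \<union> S. y \<noteq> x \<and> {x, y} \<notin> edges G) \<and> (\<forall>s\<in>S. s \<noteq> x \<longrightarrow> {x, s} \<in> edges G)"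
    proof (cases "\<exists>s\<in>S. \<exists>y\<in>C \<union> S. y \<noteq> s \<and> {s, y} \<notin> edges G")
      case True
      then show ?thesis using Sclique by blast
    next
      case False
      then have "\<And>x s. x \<in> C \<union> S \<Longrightarrow> s \<in> S \<Longrightarrow> s \<noteq> x \<Longrightarrow> {x, s} \<in> edges G"
        by (metis insert_commute)
      then show ?thesis using nonclique by metis
    qed
    then obtain x y where xy: "x \<in> C \<union> S" "y \<in> C \<union> S" "y \<noteq> x" "{x, y} \<notin> edges G"
      and xS: "\<forall>s\<in>S. s \<noteq> x \<longrightarrow> {x, s} \<in> edges G" by blast
    \<comment> \<open>Induction with \<open>x\<close> in the role of \<open>v\<close>; a
      \<open>w\<close> not adjacent to \<open>x\<close> cannot lie in \<open>S\<close>, hence lies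
      in \<open>C\<close>.\<close>
    have "\<exists>w. simplicial_in G (C \<union> S) w \<and> w \<noteq> x \<and> {x, w} \<notin> edges G"
      using less.hyps[OF small _ xy] CSX X by blast
    then show ?thesis using xS unfolding simplicial_in_def by blast
  qed
  then obtain w where w: "w \<in> C" "simplicial_in G (C \<union> S) w" by blast
  then have "simplicial_in G X w"
    using Cnbr CSX unfolding simplicial_in_def by blast
  then show ?case using w(1) CY by (auto simp: Y_def)
qed

lemma chordal_simplicial:
  assumes G: "is_graph G" and ch: "chordal G" and X: "X \<subseteq> verts G" "X \<noteq> {}"
  obtains v where "simplicial_in G X v"
proof (cases "\<exists>x\<in>X. \<exists>y\<in>X. y \<noteq> x \<and> {x, y} \<notin> edges G")
  case True
  then show thesis using that simplicial_outside_neighbourhood[OF G ch X(1)] by blast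
next
  case False
  obtain v where "v \<in> X" using X(2) by blast
  moreover have "\<forall>x\<in>X. \<forall>y\<in>X. x \<noteq> y \<longrightarrow> {x, y} \<in> edges G" using False by metis
  ultimately have "simplicial_in G X v" by (simp add: simplicial_in_def)
  then show thesis by (rule that)
qed

text \<open>Lets clique bounds control how many coloured neighbours a vertex has when the greedy
  procedures below reach it.\<close>

lemma simplicial_neighbours_clique:
  assumes "X \<subseteq> verts G" "simplicial_in G X v"
  shows "clique G (insert v {x \<in> X. {v, x} \<in> edges G})"
  unfolding clique_def
proof (intro conjI ballI impI)
  show "insert v {x \<in> X. {v, x} \<in> edges G} \<subseteq> verts G"
    using assms by (auto simp: simplicial_in_def)
next
  fix x y assume xy: "x \<in> insert v {x \<in> X. {v, x} \<in> edges G}"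
    "y \<in> insert v {x \<in> X. {v, x} \<in> edges G}" "x \<noteq> y"
  have S: "{x, y} \<in> edges G" if "x \<in> X" "y \<in> X" "{v, x} \<in> edges G" "{v, y} \<in> edges G"
    using assms(2) that xy(3) by (simp add: simplicial_in_def)
  have "{y, x} = {x, y}" by (rule insert_commute)
  then show "{x, y} \<in> edges G" using xy S by (cases "x = v"; cases "y = v") auto
qed

text \<open>The perfect elimination order as an induction rule: in the step, \<open>v\<close> is the
  last vertex of \<open>X\<close> to be treated.\<close>

lemma chordal_induct [consumes 3, case_names empty simplicial]:
  assumes G: "is_graph G" "chordal G" and X: "X \<subseteq> verts G"
    and empty: "P {}"
    and step: "\<And>X v. X \<subseteq> verts G \<Longrightarrow> simplicial_in G X v \<Longrightarrow> P (X - {v}) \<Longrightarrow> P X"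
  shows "P X"
proof -
  have "finite X" using X finite_verts[OF G(1)] finite_subset by blast
  then show ?thesis using X
  proof (induction X rule: finite_psubset_induct)
    case (psubset X)
    show ?case
    proof (cases "X = {}")
      case False
      then obtain v where v: "simplicial_in G X v" using chordal_simplicial[OF G psubset.prems] by blast
      then have "X - {v} \<subset> X" by (auto simp: simplicial_in_def)
      then show ?thesis using psubset.IH psubset.prems step[OF psubset.prems v] by blast
    qed (simp add: empty)
  qed
qed

section \<open>Greedy colourings along simplicial vertices\<close>

definition proper_on :: "'a ugraph \<Rightarrow> 'a set \<Rightarrow> ('a \<Rightarrow> 'c) \<Rightarrow> bool" where
  "proper_on G X c \<longleftrightarrow> (\<forall>x\<in>X. \<forall>y\<in>X. {x, y} \<in> edges G \<longrightarrow> c x \<noteq> c y)"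

text \<open>Greedy: \<open>v\<close> and its coloured neighbours form a clique, so at most
  \<open>k - 1\<close> colours are blocked at \<open>v\<close>.\<close>

lemma chordal_proper_colouring:
  assumes G: "is_graph G" "chordal G" and k: "\<And>K. clique G K \<Longrightarrow> card K \<le> k"
    and X: "X \<subseteq> verts G"
  shows "\<exists>c. c \<in> X \<rightarrow> {..<k} \<and> proper_on G X c"
  using G X
proof (induction X rule: chordal_induct)
  case empty
  then show ?case by (simp add: proper_on_def)
next
  case (simplicial X v)
  then obtain c where c: "c \<in> X - {v} \<rightarrow> {..<k}" "proper_on G (X - {v}) c" by blast
  define N where "N = {x \<in> X. {v, x} \<in> edges G}"
  have finN: "finite N"
    unfolding N_def using simplicial(1) finite_verts[OF G(1)] finite_subset by fastforce
  have vN: "v \<notin> N" using edge_neq[OF G(1), of v v] by (auto simp: N_def)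
  have "card (insert v N) \<le> k"
    using simplicial_neighbours_clique[OF simplicial(1,2)] k unfolding N_def by blast
  then have "card (c ` N) < card {..<k}" using finN vN card_image_le[OF finN, of c] by simp
  then obtain a where a: "a < k" "a \<notin> c ` N"
    by (metis card_mono finN finite_imageI lessThan_iff linorder_not_less subsetI)
  have "proper_on G X (c(v := a))"
    unfolding proper_on_def
  proof (intro ballI impI)
    fix x y assume xy: "x \<in> X" "y \<in> X" "{x, y} \<in> edges G"
    then have "x \<noteq> y" using edge_neq[OF G(1)] by blast
    then show "(c(v := a)) x \<noteq> (c(v := a)) y"
      using xy a(2) c(2) unfolding proper_on_def N_def by (auto simp: insert_commute)
  qed
  moreover have "c(v := a) \<in> X \<rightarrow> {..<k}" using c(1) a(1) by auto
  ultimately show ?case by blast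
qed

text \<open>Two edges of a matching that share \<open>b\<close> coincide. So a chosen vertex of
  \<open>L u\<close> blocks at most one vertex of \<open>L v\<close>.\<close>

lemma cover_cross_unique:
  assumes cov: "is_cover G L H" and uv: "u \<in> verts G" "v \<in> verts G" "{v, u} \<in> edges G"
    and b: "b \<in> L u" and a: "a \<in> L v" "a' \<in> L v" "{a, b} \<in> edges H" "{a', b} \<in> edges H"
  shows "a = a'"
proof -
  have d: "disjoint (edges_between H (L v) (L u))"
    using cov uv by (auto simp: is_cover_def)
  have e: "{a, b} \<in> edges_between H (L v) (L u)" "{a', b} \<in> edges_between H (L v) (L u)"
    using a b by (auto simp: edges_between_def)
  have "{a, b} \<inter> {a', b} \<noteq> {}" by simp
  then have "{a, b} = {a', b}" using disjointD[OF d e] by metis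
  then show ?thesis by (simp only: doubleton_eq_iff) metis
qed

text \<open>Greedy choice of one vertex per list. The colouring \<open>c\<close> is injective on
  cliques, so a clique inside \<open>W\<close> has at most \<open>t\<close> vertices. Hence
  \<open>v\<close> has fewer than \<open>t\<close> treated neighbours, and some element of
  \<open>L v\<close> stays unblocked.\<close>

lemma chordal_cover_transversal:
  assumes G: "is_graph G" "chordal G" and cov: "is_fold_cover t G L H"
    and W: "W \<subseteq> verts G" "proper_on G W c" "c ` W \<subseteq> T" "finite T" "card T \<le> t"
  shows "\<exists>f. (\<forall>x\<in>W. f x \<in> L x) \<and> (\<forall>x\<in>W. \<forall>y\<in>W. {f x, f y} \<notin> edges H)"
  using G W(1,2,3)
proof (induction W rule: chordal_induct)
  case empty
  then show ?case by simp
next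
  case (simplicial X v)
  have cov': "is_cover G L H" and H: "is_graph H"
    using cov by (auto simp: is_fold_cover_def is_cover_def)
  have "proper_on G (X - {v}) c" "c ` (X - {v}) \<subseteq> T" using simplicial by (auto simp: proper_on_def)
  then obtain f where f: "\<forall>x\<in>X - {v}. f x \<in> L x"
    "\<forall>x\<in>X - {v}. \<forall>y\<in>X - {v}. {f x, f y} \<notin> edges H"
    using simplicial by blast
  define N where "N = {x \<in> X. {v, x} \<in> edges G}"
  have finN: "finite N"
    unfolding N_def using simplicial(1) finite_verts[OF G(1)] finite_subset by fastforce
  have vN: "v \<notin> N" using edge_neq[OF G(1), of v v] by (auto simp: N_def)
  have vX: "v \<in> X" and vV: "v \<in> verts G"
    using simplicial by (auto simp: simplicial_in_def)
  have clq: "clique G (insert v N)"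
    using simplicial_neighbours_clique[OF simplicial(1,2)] unfolding N_def .
  have NX: "insert v N \<subseteq> X" using vX by (auto simp: N_def)
  have inj: "inj_on c (insert v N)"
  proof (rule inj_onI, rule ccontr)
    fix x y assume xy: "x \<in> insert v N" "y \<in> insert v N" "c x = c y" "x \<noteq> y"
    then have "{x, y} \<in> edges G" using clq unfolding clique_def by blast
    moreover have "x \<in> X" "y \<in> X" using xy(1,2) NX by blast+
    ultimately show False using simplicial(4) xy(3) unfolding proper_on_def by blast
  qed
  have "c ` insert v N \<subseteq> T" using NX simplicial(5) by (meson image_mono order_trans)
  then have "card (insert v N) \<le> card T" by (rule card_inj_on_le[OF inj _ W(4)])
  then have Nt: "card N < t" using finN vN W(5) by simp
  \<comment> \<open>\<open>B\<close> is the blocked part of \<open>L v\<close> and \<open>g\<close>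
    selects a neighbour responsible for each blocked element; the matching condition makes
    \<open>g\<close> injective, so \<open>B\<close> is no larger than \<open>N\<close>.\<close>
  define B where "B = {a \<in> L v. \<exists>x\<in>N. {a, f x} \<in> edges H}"
  define g where "g = (\<lambda>a. SOME x. x \<in> N \<and> {a, f x} \<in> edges H)"
  have g: "g a \<in> N \<and> {a, f (g a)} \<in> edges H" if "a \<in> B" for a
    using that unfolding B_def g_def by (metis (mono_tags, lifting) mem_Collect_eq someI_ex)
  have "inj_on g B"
  proof (rule inj_onI)
    fix a a' assume aa: "a \<in> B" "a' \<in> B" "g a = g a'"
    have ga: "g a \<in> X" "{v, g a} \<in> edges G" "g a \<noteq> v" using g[OF aa(1)] vN by (auto simp: N_def)
    have "g a \<in> verts G" "f (g a) \<in> L (g a)" "a \<in> L v" "a' \<in> L v"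
      using ga f(1) simplicial(1) aa by (auto simp: B_def)
    moreover have "{a, f (g a)} \<in> edges H" "{a', f (g a)} \<in> edges H"
      using g[OF aa(1)] g[OF aa(2)] aa(3) by simp_all
    ultimately show "a = a'"
      using cover_cross_unique[OF cov' _ vV ga(2)] by blast
  qed
  then have "card B \<le> card N" using g finN by (intro card_inj_on_le[of g]) auto
  moreover have "card (L v) = t" using cov vV by (simp add: is_fold_cover_def)
  ultimately have "card B < card (L v)" using Nt by simp
  then have "B \<noteq> L v" by blast
  moreover have "B \<subseteq> L v" by (auto simp: B_def)
  ultimately obtain a where a: "a \<in> L v" "a \<notin> B" by blast
  have free: "{a, f x} \<notin> edges H" if x: "x \<in> X" "x \<noteq> v" for x
  proof (cases "x \<in> N")
    case True
    then show ?thesis using a by (auto simp: B_def)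
  next
    case False
    then have "{v, x} \<notin> edges G" using x by (simp add: N_def)
    moreover have "x \<in> verts G" using x simplicial(1) by blast
    ultimately have "edges_between H (L v) (L x) = {}"
      using cov' vV x(2) by (auto simp: is_cover_def)
    then show ?thesis using a(1) f(1) x by (auto simp: edges_between_def)
  qed
  \<comment> \<open>The goal also ranges over equal \<open>x\<close> and \<open>y\<close>, where the
    pair collapses to a singleton.\<close>
  have loop: "{a, a} \<notin> edges H" using edge_neq[OF H] by blast
  show ?case
  proof (intro exI[of _ "f(v := a)"] conjI ballI)
    fix x assume "x \<in> X"
    then show "(f(v := a)) x \<in> L x" using f(1) a(1) by auto
  next
    fix x y assume "x \<in> X" "y \<in> X"
    then show "{(f(v := a)) x, (f(v := a)) y} \<notin> edges H"
      using f(2) free[of x] free[of y] loop by (auto simp: insert_commute)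
  qed
qed

text \<open>Lists are pairwise disjoint, so the transversal is injective and its image keeps the
  size of \<open>W\<close>.\<close>

lemma chordal_cover_independent:
  assumes G: "is_graph G" "chordal G" and cov: "is_fold_cover t G L H"
    and W: "W \<subseteq> verts G" "proper_on G W c" "c ` W \<subseteq> T" "finite T" "card T \<le> t"
  obtains S where "independent_set H S" "card S = card W"
proof -
  obtain f where f: "\<forall>x\<in>W. f x \<in> L x" "\<forall>x\<in>W. \<forall>y\<in>W. {f x, f y} \<notin> edges H"
    using chordal_cover_transversal[OF assms] by blast
  have "disjoint_family_on L (verts G)" and un: "(\<Union>u\<in>verts G. L u) = verts H"
    using cov by (auto simp: is_fold_cover_def is_cover_def)
  then have "inj_on f W"
    using f(1) W(1) unfolding inj_on_def disjoint_family_on_def by (metis disjoint_iff subsetD)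
  moreover have "independent_set H (f ` W)"
    using f W(1) un[symmetric] by (auto simp: independent_set_def)
  ultimately show thesis using that card_image by blast
qed

section \<open>The trivial cover\<close>

text \<open>The Cartesian product of \<open>G\<close> with the complete graph on \<open>m\<close>
  vertices; its independent sets of size \<open>card (verts G)\<close> are the proper
  \<open>m\<close>-colourings of \<open>G\<close>.\<close>

definition trivial_cover :: "nat \<Rightarrow> 'a ugraph \<Rightarrow> ('a \<times> nat) ugraph" where
  "trivial_cover m G = UGraph (verts G \<times> {..<m})
     {{p, q} | p q. p \<in> verts G \<times> {..<m} \<and> q \<in> verts G \<times> {..<m} \<and>
        (fst p = fst q \<and> snd p \<noteq> snd q \<or> {fst p, fst q} \<in> edges G \<and> snd p = snd q)}"

lemma trivial_cover_edge_iff: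
  "{p, q} \<in> edges (trivial_cover m G) \<longleftrightarrow>
     p \<in> verts G \<times> {..<m} \<and> q \<in> verts G \<times> {..<m} \<and>
     (fst p = fst q \<and> snd p \<noteq> snd q \<or> {fst p, fst q} \<in> edges G \<and> snd p = snd q)"
  (is "_ \<longleftrightarrow> ?R p q")
proof
  assume "{p, q} \<in> edges (trivial_cover m G)"
  then obtain p' q' where "{p, q} = {p', q'}" and R: "?R p' q'"
    unfolding trivial_cover_def by force
  then have "p = p' \<and> q = q' \<or> p = q' \<and> q = p'" by (simp only: doubleton_eq_iff)
  then show "?R p q"
  proof
    assume "p = q' \<and> q = p'"
    then show ?thesis using R by (auto simp: insert_commute)
  qed (use R in simp)
next
  assume "?R p q"
  then show "{p, q} \<in> edges (trivial_cover m G)" unfolding trivial_cover_def by force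
qed

lemma verts_trivial_cover [simp]: "verts (trivial_cover m G) = verts G \<times> {..<m}"
  by (simp add: trivial_cover_def)

lemma is_graph_trivial_cover:
  assumes G: "is_graph G" and m: "1 \<le> m"
  shows "is_graph (trivial_cover m G)"
proof -
  have "0 \<in> {..<m}" using m by simp
  moreover have "e \<subseteq> verts G \<times> {..<m} \<and> card e = 2" if e: "e \<in> edges (trivial_cover m G)" for e
  proof -
    obtain p q where pq: "e = {p, q}" using e by (auto simp: trivial_cover_def)
    then have "p \<noteq> q" using e edge_neq[OF G] by (auto simp: trivial_cover_edge_iff)
    then show ?thesis using e pq by (auto simp: trivial_cover_edge_iff)
  qed
  ultimately show ?thesis using G by (auto simp: is_graph_def)
qed

text \<open>An edge has only two ends, so one meeting two fibres is horizontal and determined by its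
  level \<open>i\<close>. This yields the matching condition.\<close>

lemma trivial_cover_between:
  assumes e: "e \<in> edges_between (trivial_cover m G) ({u} \<times> {..<m}) ({v} \<times> {..<m})" and uv: "u \<noteq> v"
  shows "{u, v} \<in> edges G \<and> (\<exists>i<m. e = {(u, i), (v, i)})"
proof -
  have eE: "e \<in> edges (trivial_cover m G)" using e by (simp add: edges_between_def)
  then obtain p q where pq: "e = {p, q}" by (auto simp: trivial_cover_def)
  obtain i j where "(u, i) \<in> e" "(v, j) \<in> e" using e by (auto simp: edges_between_def)
  then have "e = {(u, i), (v, j)}" using uv pq by auto
  then show ?thesis using eE uv by (auto simp: trivial_cover_edge_iff)
qed

text \<open>Serves twice: for the lower bound on the DP-chromatic number, and to show that
  \<open>t\<close>-fold covers exist.\<close>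

lemma trivial_cover_fold_cover:
  assumes G: "is_graph G" and m: "1 \<le> m"
  shows "is_fold_cover m G (\<lambda>u. {u} \<times> {..<m}) (trivial_cover m G)"
proof -
  have "clique (trivial_cover m G) ({u} \<times> {..<m})" if "u \<in> verts G" for u
    using that by (auto simp: clique_def trivial_cover_edge_iff)
  moreover have "disjoint (edges_between (trivial_cover m G) ({u} \<times> {..<m}) ({v} \<times> {..<m}))"
    if "{u, v} \<in> edges G" for u v
  proof -
    have uv: "u \<noteq> v" using edge_neq[OF G that] .
    show ?thesis
      unfolding disjoint_def
    proof (intro ballI impI)
      fix e e' assume e: "e \<in> edges_between (trivial_cover m G) ({u} \<times> {..<m}) ({v} \<times> {..<m})"
        "e' \<in> edges_between (trivial_cover m G) ({u} \<times> {..<m}) ({v} \<times> {..<m})" "e \<noteq> e'"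
      obtain i j where "e = {(u, i), (v, i)}" "e' = {(u, j), (v, j)}"
        using trivial_cover_between[OF e(1) uv] trivial_cover_between[OF e(2) uv] by blast
      then show "e \<inter> e' = {}" using e(3) uv by auto
    qed
  qed
  moreover have "edges_between (trivial_cover m G) ({u} \<times> {..<m}) ({v} \<times> {..<m}) = {}"
    if "u \<noteq> v" "{u, v} \<notin> edges G" for u v
  proof (rule ccontr)
    assume "\<not> ?thesis"
    then obtain e where "e \<in> edges_between (trivial_cover m G) ({u} \<times> {..<m}) ({v} \<times> {..<m})" by blast
    then show False using trivial_cover_between that by metis
  qed
  ultimately show ?thesis
    using is_graph_trivial_cover[OF G m]
    by (auto simp: is_fold_cover_def is_cover_def disjoint_family_on_def)
qed

text \<open>The independent set has exactly one point over each vertex of \<open>G\<close>, and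
  points over adjacent vertices sit on different levels; so the levels over \<open>K\<close> are
  distinct.\<close>

lemma trivial_cover_coloring_clique:
  assumes G: "is_graph G" and S: "is_coloring G (trivial_cover m G) S" and K: "clique G K"
  shows "card K \<le> m"
proof -
  have ind: "independent_set (trivial_cover m G) S" and card: "card S = card (verts G)"
    using S by (auto simp: is_coloring_def)
  have SV: "S \<subseteq> verts G \<times> {..<m}" using ind by (simp add: independent_set_def)
  have nE: "{p, q} \<notin> edges (trivial_cover m G)" if "p \<in> S" "q \<in> S" for p q
    using ind that by (simp add: independent_set_def)
  have inj: "inj_on fst S"
  proof (rule inj_onI)
    fix p q assume pq: "p \<in> S" "q \<in> S" "fst p = fst q"
    then have "snd p = snd q" using nE[OF pq(1,2)] SV by (auto simp: trivial_cover_edge_iff)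
    then show "p = q" using pq(3) by (simp add: prod_eq_iff)
  qed
  have "fst ` S = verts G"
    using SV card_image[OF inj] card finite_verts[OF G] by (intro card_subset_eq) auto
  then have KS: "K \<subseteq> fst ` S" using K by (simp add: clique_def)
  define Q where "Q = {p \<in> S. fst p \<in> K}"
  have "inj_on snd Q"
  proof (rule inj_onI)
    fix p q assume pq: "p \<in> Q" "q \<in> Q" "snd p = snd q"
    have "fst p = fst q"
    proof (rule ccontr)
      assume "fst p \<noteq> fst q"
      then have "{fst p, fst q} \<in> edges G" using K pq by (auto simp: clique_def Q_def)
      then show False
        using nE[of p q] pq SV by (auto simp: trivial_cover_edge_iff Q_def)
    qed
    then show "p = q" using pq(3) by (simp add: prod_eq_iff)
  qed
  then have "card Q \<le> card {..<m}" using SV by (intro card_inj_on_le[of snd]) (auto simp: Q_def)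
  moreover have "fst ` Q = K" using KS by (auto simp: Q_def)
  moreover have "card (fst ` Q) = card Q"
    using inj by (intro card_image) (auto simp: Q_def inj_on_def)
  ultimately show ?thesis by simp
qed

section \<open>Largest colour classes and cliques\<close>

text \<open>Averaging: the \<open>t\<close> largest values of \<open>g\<close> carry at least the
  fraction \<open>t / card A\<close> of the total. Dropping a minimal element at a time gives an
  induction, with denominators cleared to remain in \<open>nat\<close>.\<close>

lemma exists_heavy_subset:
  fixes g :: "'c \<Rightarrow> nat"
  assumes "finite A" "t \<le> card A"
  shows "\<exists>T\<subseteq>A. card T = t \<and> t * sum g A \<le> card A * sum g T"
  using assms
proof (induction "card A" arbitrary: A)
  case 0
  then show ?case by auto
next
  case (Suc n)
  show ?case
  proof (cases "t = Suc n \<or> t = 0")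
    case True
    then show ?thesis
    proof
      assume "t = Suc n"
      then show ?thesis using Suc.hyps(2) by (intro exI[of _ A]) auto
    qed (intro exI[of _ "{}"], auto)
  next
    case False
    then have tn: "t \<le> n" "0 < n" using Suc by auto
    have "A \<noteq> {}" using Suc.hyps(2) by auto
    then obtain a where a: "a \<in> A" "\<And>x. x \<in> A \<Longrightarrow> g a \<le> g x"
      using ex_min_if_finite[of "g ` A"] Suc.prems(1)
      by (metis arg_min_if_finite(1) arg_min_least)
    have cA: "card (A - {a}) = n" using a(1) Suc.hyps(2) by simp
    obtain T where T: "T \<subseteq> A - {a}" "card T = t" "t * sum g (A - {a}) \<le> n * sum g T"
      using Suc.hyps(1)[of "A - {a}"] cA tn Suc.prems(1) by auto
    have sA: "sum g A = g a + sum g (A - {a})"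
      using a(1) Suc.prems(1) by (simp add: sum.remove)
    \<comment> \<open>The minimum is at most the average of the other \<open>n\<close> values, so
      dropping \<open>a\<close> does not lower the average.\<close>
    have "n * g a \<le> sum g (A - {a})"
      using sum_bounded_below[of "A - {a}" "g a" g] a(2) cA by simp
    then have "n * sum g A \<le> Suc n * sum g (A - {a})" by (simp add: sA algebra_simps)
    then have "t * (n * sum g A) \<le> t * (Suc n * sum g (A - {a}))" by (rule mult_left_mono) simp
    also have "\<dots> \<le> Suc n * (n * sum g T)"
      using mult_left_mono[OF T(3), of "Suc n"] by (simp add: algebra_simps)
    finally have "n * (t * sum g A) \<le> n * (Suc n * sum g T)" by (simp only: mult.left_commute)
    then have "t * sum g A \<le> Suc n * sum g T" using tn(2) by (simp only: mult_le_cancel1)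
    then show ?thesis using T(1,2) Suc.hyps(2) by auto
  qed
qed

text \<open>The weights are the sizes of the colour classes, which are disjoint, so a weight sum
  counts the vertices coloured from \<open>T\<close>.\<close>

lemma exists_heavy_colours:
  assumes V: "finite V" and c: "c \<in> V \<rightarrow> {..<k::nat}" and t: "t \<le> k"
  obtains T where "T \<subseteq> {..<k}" "card T = t" "t * card V \<le> k * card {v \<in> V. c v \<in> T}"
proof -
  define g where "g i = card {v \<in> V. c v = i}" for i
  have count: "sum g T = card {v \<in> V. c v \<in> T}" if "T \<subseteq> {..<k}" for T
  proof -
    have "finite T" using that finite_subset by blast
    then have "sum g T = card (\<Union>i\<in>T. {v \<in> V. c v = i})"
      unfolding g_def using V by (intro card_UN_disjoint[symmetric]) auto
    also have "(\<Union>i\<in>T. {v \<in> V. c v = i}) = {v \<in> V. c v \<in> T}" by auto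
    finally show ?thesis .
  qed
  obtain T where T: "T \<subseteq> {..<k}" "card T = t" "t * sum g {..<k} \<le> k * sum g T"
    using exists_heavy_subset[of "{..<k}" t g] t by auto
  have "{v \<in> V. c v \<in> {..<k}} = V" using c by auto
  then show thesis using that[OF T(1,2)] T(3) count[OF T(1)] count[of "{..<k}"] by simp
qed

lemma card_le_independence_number:
  assumes "is_graph H" "independent_set H S"
  shows "card S \<le> independence_number H"
proof -
  have "{S. independent_set H S} \<subseteq> Pow (verts H)" by (auto simp: independent_set_def)
  then have "finite {S. independent_set H S}"
    using finite_verts[OF assms(1)] finite_subset by blast
  then show ?thesis unfolding independence_number_def using assms(2) by (intro Max_ge) auto
qed

lemma largest_clique_exists:
  assumes G: "is_graph G"
  obtains K where "clique G K" "1 \<le> card K" "\<And>K'. clique G K' \<Longrightarrow> card K' \<le> card K"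
proof -
  obtain v where v: "v \<in> verts G" using G by (auto simp: is_graph_def)
  have cv: "clique G {v}" using v by (simp add: clique_def)
  have b: "card K' \<le> card (verts G)" if "clique G K'" for K'
    using that finite_verts[OF G] by (simp add: clique_def card_mono)
  obtain K where K: "clique G K" "\<And>K'. clique G K' \<Longrightarrow> card K' \<le> card K"
    using ex_has_greatest_nat[of "clique G" "{v}" card "Suc (card (verts G))"] cv b
    by (auto simp: less_Suc_eq_le)
  then show thesis using that[OF K(1) _ K(2)] K(2)[OF cv] by simp
qed

section \<open>Clique number, DP-chromatic number and the bound for each \<open>t\<close>\<close>

theorem corollary17:
  fixes G :: "'a ugraph"
  assumes "is_graph G" and "chordal G"
  shows "partially_DP_nice G"
proof -
  note G = assms
  obtain K where K: "clique G K" "1 \<le> card K" "\<And>K'. clique G K' \<Longrightarrow> card K' \<le> card K"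
    using largest_clique_exists[OF G(1)] by blast
  define k where "k = card K"
  obtain c where c: "c \<in> verts G \<rightarrow> {..<k}" "proper_on G (verts G) c"
    using chordal_proper_colouring[OF G K(3), of "verts G"] k_def by blast
  \<comment> \<open>The predicate whose least element is the DP-chromatic number;
    \<open>colourable k\<close> shows that this least element is attained.\<close>
  define colourable where "colourable m \<longleftrightarrow> 1 \<le> m \<and>
    (\<forall>(L :: 'a \<Rightarrow> nat set) H. is_fold_cover m G L H \<longrightarrow> (\<exists>S. is_coloring G H S))" for m
  have "\<exists>S. is_coloring G H S" if "is_fold_cover k G L H" for L :: "'a \<Rightarrow> nat set" and H
    using chordal_cover_independent[OF G that order_refl c(2), of "{..<k}"] c(1)
    unfolding is_coloring_def by (metis image_subset_iff_funcset card_lessThan finite_lessThan order_refl)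
  then have "colourable k" using K(2) by (simp add: colourable_def k_def)
  moreover define x where "x = DP_chromatic_number G"
  moreover have "x = (LEAST m. colourable m)"
    by (simp add: x_def DP_chromatic_number_def colourable_def)
  ultimately have x: "colourable x" by (metis LeastI)
  have kx: "k \<le> x"
  proof -
    have "is_fold_cover x G (\<lambda>u. {u} \<times> {..<x}) (trivial_cover x G)"
      using trivial_cover_fold_cover[OF G(1)] x by (simp add: colourable_def)
    \<comment> \<open>The trivial cover lives on pairs, whereas \<open>colourable\<close> speaks of
      covers on \<open>nat\<close>; colourability is transferred between the two.\<close>
    then obtain S where "is_coloring G (trivial_cover x G) S"
      using x fold_cover_over_nat unfolding colourable_def by metis
    then show ?thesis using trivial_cover_coloring_clique[OF G(1) _ K(1)] by (simp add: k_def)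
  qed
  have "real t * real (card (verts G)) / real x \<le> real (partial_DP_chromatic_number t G)"
    if t: "1 \<le> t" "t \<le> x" for t
  proof -
    have "\<exists>a (L :: 'a \<Rightarrow> nat set) H. is_fold_cover t G L H \<and> a = independence_number H"
      using fold_cover_over_nat[OF trivial_cover_fold_cover[OF G(1) t(1)]] by metis
    \<comment> \<open>A cover attaining the minimum exists, so it suffices to find a large
      independent set in this one \<open>H\<close>.\<close>
    then obtain L :: "'a \<Rightarrow> nat set" and H where H: "is_fold_cover t G L H"
      "partial_DP_chromatic_number t G = independence_number H"
      unfolding partial_DP_chromatic_number_def by (rule LeastI_ex[THEN exE]) blast
    define n where "n = card (verts G)"
    \<comment> \<open>Only \<open>k \<le> x\<close> has been established, so \<open>t\<close> may
      formally exceed the number \<open>k\<close> of colours; then all colours are taken and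
      \<open>W\<close> is the whole vertex set.\<close>
    obtain T where T: "T \<subseteq> {..<k}" "card T = min t k"
      "min t k * n \<le> k * card {v \<in> verts G. c v \<in> T}"
      using exists_heavy_colours[OF finite_verts[OF G(1)] c(1), of "min t k"] n_def by auto
    define W where "W = {v \<in> verts G. c v \<in> T}"
    have "finite T" using T(1) finite_subset by blast
    then obtain S where S: "independent_set H S" "card S = card W"
      using chordal_cover_independent[OF G H(1), of W c T] c(2) T(2)
      by (auto simp: W_def proper_on_def)
    have "is_graph H" using H(1) by (simp add: is_fold_cover_def is_cover_def)
    then have W: "card W \<le> partial_DP_chromatic_number t G"
      using card_le_independence_number S H(2) by metis
    \<comment> \<open>For \<open>t \<le> k\<close> the averaging bound is weakened by
      \<open>k \<le> x\<close>; for larger \<open>t\<close>, it gives \<open>n \<le> card W\<close>,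
      to be combined with \<open>t \<le> x\<close>.\<close>
    have "t * n \<le> x * card W"
    proof (cases "t \<le> k")
      case True
      then have "t * n \<le> k * card W" using T(3) by (simp add: W_def)
      also have "\<dots> \<le> x * card W" using kx by simp
      finally show ?thesis .
    next
      case False
      then have "k * n \<le> k * card W" using T(3) by (simp add: W_def)
      then have "n \<le> card W" using K(2) by (simp add: k_def)
      then show ?thesis using t(2) by (rule mult_le_mono[rotated])
    qed
    also have "\<dots> \<le> x * partial_DP_chromatic_number t G" using W by simp
    finally have "real t * real n \<le> real x * real (partial_DP_chromatic_number t G)"
      by (metis of_nat_le_iff of_nat_mult)
    then show ?thesis using t by (simp add: n_def divide_le_eq mult.commute)
  qed
  then show ?thesis unfolding partially_DP_nice_def x_def by auto
qed

end
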